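(* Let $A\subset\mathbb N$ be an infinite set. Then $\underline D(A)=0$ if and only if for each positive integer $k\ge2$ the set $R^k(A)$ is dense in $\mathbb R_+^{k-1}$.
   Context: $\mathbb N$ is the set of positive integers and $\mathbb R_+=(0,\infty)$. For $k\ge2$ and $A\subset\mathbb N$, $$R^k(A)=\left\{\left(\tfrac{a_1}{b},\dots,\tfrac{a_{k-1}}{b}\right): a_1,\dots,a_{k-1},b\in A\right\}$$ (arbitrary elements of $A$). The dispersion of an infinite set $A=\{a_1<a_2<\cdots\}\subset\mathbb N$ is $$\underline D(A)=\liminf_{n\to\infty}\frac1{a_n}\max\{a_1,\,a_{i+1}-a_i: i\in\{1,\dots,n-1\}\}.$$ *)

theory Defs
  imports "HOL-Analysis.Analysis"
begin

(* The i-th coordinate is a i / b for 1 <= i <= k - 1. Points of R^(k-1) are functions that are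
   extensional (undefined) outside {1..<k}, as in the carrier of product_topology. *)
definition ratio_set :: "nat \<Rightarrow> nat set \<Rightarrow> (nat \<Rightarrow> real) set" where
  "ratio_set k A =
     {(\<lambda>i\<in>{1..<k}. real (a i) / real b) | a b. a \<in> {1..<k} \<rightarrow> A \<and> b \<in> A}"

(* R_+^(k-1) with its usual topology. *)
definition pos_orthant :: "nat \<Rightarrow> (nat \<Rightarrow> real) topology" where
  "pos_orthant k = product_topology (\<lambda>_. top_of_set {0<..}) {1..<k}"

(* For infinite A = {a_1 < a_2 < ...}, enumerate A n = a_(n+1), so the n-th term here is the
   quotient (1 / a_(n+1)) * max {a_1, a_(i+1) - a_i : 1 <= i <= n}. *)
definition dispersion :: "nat set \<Rightarrow> ereal" where
  "dispersion A =
     liminf (\<lambda>n. ereal (1 / real (enumerate A n) *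
       Max (insert (real (enumerate A 0))
         ((\<lambda>i. real (enumerate A (Suc i)) - real (enumerate A i)) ` {..<n}))))"

end

theory Submission
  imports Defs
begin

text \<open>
  Both sides say that \<open>A\<close>, rescaled by a suitable one of its elements to fill the interval up to \<open>1\<close>,
  comes within any prescribed distance of every point of \<open>(0, 1]\<close>.

  On the side of the dispersion, the terms of the limit inferior are positive, so it vanishes as soon
  as a \<^emph>\<open>single\<close> term lies below each \<open>\<epsilon> > 0\<close> (\<open>liminf_pos_eq_0_iff\<close>). Thus \<open>dispersion A = 0\<close> means
  that for each \<open>\<epsilon>\<close> some \<open>c \<in> A\<close> has the property that the first element of \<open>A\<close> and all gaps of \<open>A\<close>
  below \<open>c\<close> are shorter than \<open>\<epsilon> * c\<close> (\<open>dispersion_eq_0_iff\<close>). On the side of the ratio sets, density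
  is simultaneous approximation of finitely many positive reals by fractions with a common denominator
  (\<open>ratio_set_dense_iff\<close>).

  If the gaps below \<open>c\<close> are short compared with \<open>c\<close>, choose \<open>b \<in> A\<close> just below \<open>c / M\<close>, where \<open>M\<close> bounds
  the given reals \<open>x i\<close>. All the products \<open>x i * b\<close> then lie below \<open>c\<close>, so each of them has an element of
  \<open>A\<close> close to it, with an error that is small compared with \<open>c\<close> and hence with \<open>b\<close>
  (\<open>approximable_if_short_gaps\<close>). Conversely, let elements of \<open>A\<close> approximate the grid
  \<open>b / m, 2 * b / m, \<dots>, b\<close>. They cut every longer gap of \<open>A\<close> below the last of them, \<open>c\<close>, so that all
  gaps below \<open>c\<close> have length \<open>O(b / m) = O(c / m)\<close> (\<open>short_gaps_if_approximable\<close>).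
\<close>

section \<open>Vanishing dispersion as short gaps\<close>

text \<open>
  A positive sequence with infimum \<open>0\<close> comes close to \<open>0\<close> infinitely often, because finitely many of its
  terms are bounded away from \<open>0\<close>.
\<close>

lemma liminf_pos_eq_0_iff:
  fixes f :: "nat \<Rightarrow> real"
  assumes pos: "\<And>n. 0 < f n"
  shows "liminf (\<lambda>n. ereal (f n)) = 0 \<longleftrightarrow> (\<forall>e>0. \<exists>n. f n < e)"
proof
  assume lim: "liminf (\<lambda>n. ereal (f n)) = 0"
  show "\<forall>e>0. \<exists>n. f n < e"
  proof (intro allI impI, rule ccontr)
    fix e :: real assume "0 < e" "\<not> (\<exists>n. f n < e)"
    then have "ereal e \<le> liminf (\<lambda>n. ereal (f n))"
      by (intro Liminf_bounded always_eventually) (auto simp: not_less)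
    with lim \<open>0 < e\<close> show False by simp
  qed
next
  assume small: "\<forall>e>0. \<exists>n. f n < e"
  have "0 \<le> liminf (\<lambda>n. ereal (f n))"
    using pos by (intro Liminf_bounded always_eventually) (auto intro: less_imp_le)
  moreover have "\<not> 0 < liminf (\<lambda>n. ereal (f n))"
  proof
    assume "0 < liminf (\<lambda>n. ereal (f n))"
    then obtain e where e: "0 < ereal e" "ereal e < liminf (\<lambda>n. ereal (f n))"
      using ereal_dense2 by blast
    then have "eventually (\<lambda>n. ereal e < ereal (f n)) sequentially"
      by (intro less_LiminfD)
    then obtain N where N: "\<And>n. N \<le> n \<Longrightarrow> e < f n"
      by (auto simp: eventually_sequentially)
    let ?S = "insert e (f ` {..<N})"
    have "0 < Min ?S" using e pos by (subst Min_gr_iff) auto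
    with small obtain n where "f n < Min ?S" by blast
    then have "f n < e" "n < N \<Longrightarrow> f n < f n" by (auto simp: Min_gr_iff)
    with N[of n] show False by (cases "n < N") auto
  qed
  ultimately show "liminf (\<lambda>n. ereal (f n)) = 0" by (auto simp: not_less)
qed

definition short_gaps :: "nat set \<Rightarrow> nat \<Rightarrow> real \<Rightarrow> bool" where
  "short_gaps A n d \<longleftrightarrow> real (enumerate A 0) < d \<and>
     (\<forall>i<n. real (enumerate A (Suc i)) - real (enumerate A i) < d)"

lemma dispersion_eq_0_iff:
  assumes "A \<subseteq> {0<..}" and "infinite A"
  shows "dispersion A = 0 \<longleftrightarrow> (\<forall>e>0. \<exists>n. short_gaps A n (e * real (enumerate A n)))"
proof -
  let ?S = "\<lambda>n. insert (real (enumerate A 0))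
         ((\<lambda>i. real (enumerate A (Suc i)) - real (enumerate A i)) ` {..<n})"
  have en: "0 < real (enumerate A n)" for n
    using enumerate_in_set[OF assms(2), of n] assms(1) by auto
  have "0 < Max (?S n)" for n
    using en[of 0] by (subst Max_gr_iff) auto
  then have pos: "0 < 1 / real (enumerate A n) * Max (?S n)" for n
    using en[of n] by simp
  have "1 / real (enumerate A n) * Max (?S n) < e \<longleftrightarrow> short_gaps A n (e * real (enumerate A n))"
    for n e
  proof -
    have "1 / real (enumerate A n) * Max (?S n) < e \<longleftrightarrow> Max (?S n) < e * real (enumerate A n)"
      using en[of n] by (simp add: field_simps)
    also have "\<dots> \<longleftrightarrow> short_gaps A n (e * real (enumerate A n))"
      by (subst Max_less_iff) (auto simp: short_gaps_def)
    finally show ?thesis .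
  qed
  then show ?thesis
    unfolding dispersion_def liminf_pos_eq_0_iff[OF pos] by simp
qed

section \<open>Density as simultaneous approximation\<close>

text \<open>
  Only finitely many coordinates are involved, so the cubes around a point form a basis of its
  neighbourhoods; and \<open>{0<..}\<close> is open, so small cubes stay inside the orthant.
\<close>

lemma ratio_set_dense_iff:
  "pos_orthant k closure_of ratio_set k A = topspace (pos_orthant k) \<longleftrightarrow>
    (\<forall>x e. (\<forall>i\<in>{1..<k}. 0 < x i) \<longrightarrow> 0 < e \<longrightarrow>
      (\<exists>a b. a \<in> {1..<k} \<rightarrow> A \<and> b \<in> A \<and> (\<forall>i\<in>{1..<k}. \<bar>real (a i) / real b - x i\<bar> < e)))"
    (is "?dense \<longleftrightarrow> ?approx")
proof
  assume dense: ?dense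
  show ?approx
  proof (intro allI impI)
    fix x :: "nat \<Rightarrow> real" and e :: real
    assume x: "\<forall>i\<in>{1..<k}. 0 < x i" and e: "0 < e"
    let ?B = "PiE {1..<k} (\<lambda>i. {0<..} \<inter> ball (x i) e)"
    have "restrict x {1..<k} \<in> pos_orthant k closure_of ratio_set k A"
      unfolding dense using x by (auto simp: pos_orthant_def)
    moreover have "openin (pos_orthant k) ?B"
      unfolding pos_orthant_def by (subst openin_PiE) (auto simp: openin_open)
    moreover have "restrict x {1..<k} \<in> ?B"
      using x e by auto
    ultimately obtain y where "y \<in> ratio_set k A" "y \<in> ?B"
      unfolding in_closure_of by blast
    then obtain a b where ab: "a \<in> {1..<k} \<rightarrow> A" "b \<in> A"
      and y: "(\<lambda>i\<in>{1..<k}. real (a i) / real b) \<in> ?B"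
      by (auto simp: ratio_set_def)
    have "\<bar>real (a i) / real b - x i\<bar> < e" if "i \<in> {1..<k}" for i
      using PiE_mem[OF y that] that by (simp add: dist_real_def abs_minus_commute)
    with ab show "\<exists>a b. a \<in> {1..<k} \<rightarrow> A \<and> b \<in> A \<and>
        (\<forall>i\<in>{1..<k}. \<bar>real (a i) / real b - x i\<bar> < e)" by blast
  qed
next
  assume approx: ?approx
  have "x \<in> pos_orthant k closure_of ratio_set k A" if x: "x \<in> topspace (pos_orthant k)" for x
  proof (unfold in_closure_of, intro conjI allI impI)
    fix U assume U: "x \<in> U \<and> openin (pos_orthant k) U"
    then have "\<forall>x\<in>U. \<exists>X. finite {i \<in> {1..<k}. X i \<noteq> topspace (top_of_set {0<..})} \<and>
        (\<forall>i\<in>{1..<k}. openin (top_of_set {0<..}) (X i)) \<and> x \<in> PiE {1..<k} X \<and> PiE {1..<k} X \<subseteq> U"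
      unfolding pos_orthant_def openin_product_topology_alt by simp
    with U obtain X where X: "\<And>i. i \<in> {1..<k} \<Longrightarrow> openin (top_of_set {0<..}) (X i)"
      "x \<in> PiE {1..<k} X" "PiE {1..<k} X \<subseteq> U"
      by meson
    have "\<exists>e>0. ball (x i) e \<subseteq> X i" if i: "i \<in> {1..<k}" for i
    proof -
      have "open (X i)" using X(1)[OF i] by (simp add: openin_open_eq)
      moreover have "x i \<in> X i" using X(2) i by auto
      ultimately show ?thesis using open_contains_ball by blast
    qed
    then obtain r where r: "\<And>i. i \<in> {1..<k} \<Longrightarrow> 0 < r i \<and> ball (x i) (r i) \<subseteq> X i"
      by metis
    define e where "e = Min (insert 1 (r ` {1..<k}))"
    have "0 < e" unfolding e_def using r by (subst Min_gr_iff) auto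
    have er: "e \<le> r i" if "i \<in> {1..<k}" for i
      unfolding e_def using that by (intro Min_le) auto
    have "\<forall>i\<in>{1..<k}. 0 < x i"
      using x by (auto simp: pos_orthant_def)
    then obtain a b where ab: "a \<in> {1..<k} \<rightarrow> A" "b \<in> A"
      and near: "\<And>i. i \<in> {1..<k} \<Longrightarrow> \<bar>real (a i) / real b - x i\<bar> < e"
      using approx[rule_format, of x e] \<open>0 < e\<close> by blast
    have "real (a i) / real b \<in> X i" if i: "i \<in> {1..<k}" for i
    proof -
      have "real (a i) / real b \<in> ball (x i) (r i)"
        using near[OF i] er[OF i] by (simp add: dist_real_def abs_minus_commute)
      with r[OF i] show ?thesis by blast
    qed
    then have "(\<lambda>i\<in>{1..<k}. real (a i) / real b) \<in> PiE {1..<k} X" by auto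
    with X(3) ab show "\<exists>y. y \<in> ratio_set k A \<and> y \<in> U"
      unfolding ratio_set_def by blast
  qed (use x in simp)
  then show ?dense
    using closure_of_subset_topspace[of "pos_orthant k" "ratio_set k A"] by blast
qed

section \<open>Short gaps and approximation\<close>

text \<open>The witness is the largest element of \<open>A\<close> up to \<open>y\<close>; the next one lies beyond \<open>y\<close>.\<close>

lemma short_gaps_imp_near_below:
  assumes "infinite A" and gaps: "short_gaps A n d"
    and y: "d \<le> y" "y \<le> real (enumerate A n)"
  obtains a where "a \<in> A" and "real a \<le> y" and "y < real a + d"
proof -
  define I where "I = {i. i \<le> n \<and> real (enumerate A i) \<le> y}"
  define j where "j = Max I"
  have "finite I" by (simp add: I_def)
  moreover have "0 \<in> I"
    using gaps y by (simp add: I_def short_gaps_def)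
  ultimately have j: "j \<in> I" and le_j: "\<And>i. i \<in> I \<Longrightarrow> i \<le> j"
    unfolding j_def by (blast intro: Max_in, simp)
  have "y < real (enumerate A j) + d"
  proof (cases "j = n")
    case True
    \<comment> \<open>There is no gap after the last index; here \<open>y\<close> is itself the element of \<open>A\<close>, and \<open>d\<close> is
      positive because it exceeds the first element.\<close>
    then show ?thesis using gaps y by (simp add: short_gaps_def)
  next
    case False
    with j have "j < n" by (simp add: I_def)
    moreover have "Suc j \<notin> I" using le_j[of "Suc j"] by auto
    ultimately show ?thesis using gaps by (force simp: I_def short_gaps_def)
  qed
  with j show thesis
    using that[of "enumerate A j"] enumerate_in_set[OF assms(1)] by (simp add: I_def)
qed

text \<open>
  The denominator \<open>b\<close> has to serve two purposes: it is small enough for all \<open>x i * b\<close> to stay in the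
  range where the gaps are controlled, and at least \<open>c / (2 * M)\<close>, so that a gap of length \<open>\<delta> * c\<close> is
  at most \<open>2 * M * \<delta> * b\<close>.
\<close>

lemma approximable_if_short_gaps:
  fixes x :: "nat \<Rightarrow> real"
  assumes A: "A \<subseteq> {0<..}" "infinite A"
    and gaps: "\<forall>e>0. \<exists>n. short_gaps A n (e * real (enumerate A n))"
    and I: "finite I" and x: "\<forall>i\<in>I. 0 < x i" and e: "0 < e"
  shows "\<exists>a b. a \<in> I \<rightarrow> A \<and> b \<in> A \<and> (\<forall>i\<in>I. \<bar>real (a i) / real b - x i\<bar> < e)"
proof -
  define M where "M = Max (insert 1 (x ` I))"
  define \<mu> where "\<mu> = Min (insert 1 (insert e (x ` I)))"
  have M: "1 \<le> M" "\<And>i. i \<in> I \<Longrightarrow> x i \<le> M"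
    unfolding M_def using I by (auto intro!: Max_ge simp del: Max_insert)
  have \<mu>_le: "\<mu> \<le> 1" "\<mu> \<le> e" "\<And>i. i \<in> I \<Longrightarrow> \<mu> \<le> x i"
    unfolding \<mu>_def using I by (auto intro!: Min_le simp del: Min_insert)
  have "0 < \<mu>"
    unfolding \<mu>_def using I x e by (subst Min_gr_iff) auto
  \<comment> \<open>With this value \<open>2 * M * \<delta> = \<mu>\<close> is at most \<open>1\<close>, \<open>e\<close> and every \<open>x i\<close>: these three bounds keep \<open>b\<close>
    above \<open>c / (2 * M)\<close>, control the error, and place \<open>x i * b\<close> above the first element of \<open>A\<close>.\<close>
  define \<delta> where "\<delta> = \<mu> / (2 * M)"
  have "0 < \<delta>" using \<open>0 < \<mu>\<close> M(1) by (simp add: \<delta>_def)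
  with gaps obtain n where n: "short_gaps A n (\<delta> * real (enumerate A n))" by blast
  define c where "c = real (enumerate A n)"
  have c: "0 < c"
    using enumerate_in_set[OF A(2), of n] A(1) by (auto simp: c_def)
  note near = short_gaps_imp_near_below[OF A(2) n, folded c_def]
  have \<delta>c: "\<delta> * c \<le> c / (2 * M)"
    using \<mu>_le(1) c M(1) by (simp add: \<delta>_def divide_right_mono)
  have half: "c / M = c / (2 * M) + c / (2 * M)" using M(1) by (simp add: field_simps)
  have "0 < c / (2 * M)" using c M(1) by simp
  obtain b where b: "b \<in> A" "real b \<le> c / M" "c / M < real b + \<delta> * c"
  proof (rule near[of "c / M"])
    show "\<delta> * c \<le> c / M" using \<delta>c half \<open>0 < c / (2 * M)\<close> by linarith
    show "c / M \<le> c" using c M(1) by (simp add: field_simps)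
  qed
  have b_lower: "c / (2 * M) < real b" using b(3) \<delta>c half by linarith
  then have "0 < real b" using \<open>0 < c / (2 * M)\<close> by linarith
  have gap_b: "\<delta> * c \<le> \<mu> * real b"
    using mult_left_mono[OF less_imp_le[OF b_lower], of \<mu>] \<open>0 < \<mu>\<close> by (simp add: \<delta>_def)
  have "\<exists>a\<in>A. \<bar>real a / real b - x i\<bar> < e" if i: "i \<in> I" for i
  proof -
    obtain a where a: "a \<in> A" "real a \<le> x i * real b" "x i * real b < real a + \<delta> * c"
    proof (rule near[of "x i * real b"])
      show "\<delta> * c \<le> x i * real b"
        using gap_b mult_right_mono[OF \<mu>_le(3)[OF i], of "real b"] by simp
      have "x i * real b \<le> M * (c / M)"
        using M i x b(2) by (intro mult_mono) auto
      then show "x i * real b \<le> c" using M(1) by simp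
    qed
    have "x i * real b - real a < e * real b"
      using a(3) gap_b mult_right_mono[OF \<mu>_le(2), of "real b"] by simp
    then have "x i - real a / real b < e"
      using \<open>0 < real b\<close> by (simp add: field_simps)
    moreover have "real a / real b \<le> x i"
      using a(2) \<open>0 < real b\<close> by (simp add: field_simps)
    ultimately have "\<bar>real a / real b - x i\<bar> < e" by simp
    with a(1) show ?thesis by blast
  qed
  then obtain a where "\<And>i. i \<in> I \<Longrightarrow> a i \<in> A \<and> \<bar>real (a i) / real b - x i\<bar> < e"
    by metis
  with b(1) show ?thesis by blast
qed

text \<open>
  An error of \<open>b / m\<close> in approximating the grid of mesh \<open>b / m\<close> suffices: inside a gap of \<open>A\<close> of length at
  least \<open>3 * b / m\<close> some grid point is at distance at least \<open>b / m\<close> from both ends, and so its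
  approximation would be an element of \<open>A\<close> inside the gap.
\<close>

lemma short_gaps_if_approximable:
  assumes A: "A \<subseteq> {0<..}" "infinite A" and m: "2 \<le> m"
    and a: "a \<in> {1..m} \<rightarrow> A" and b: "b \<in> A"
    and near: "\<And>j. j \<in> {1..m} \<Longrightarrow> \<bar>real (a j) / real b - real j / real m\<bar> < 1 / real m"
  shows "\<exists>n. short_gaps A n (6 / real m * real (enumerate A n))"
proof -
  have b0: "0 < real b" using A b by auto
  define h where "h = real b / real m"
  have h: "0 < h" using b0 m by (simp add: h_def)
  have mh: "real m * h = real b" using m by (simp add: h_def)
  have grid: "real j * h - h < real (a j)" "real (a j) < real j * h + h" if "j \<in> {1..m}" for j
  proof -
    have "real (a j) / real b = real (a j) / h / real m" using m by (simp add: h_def)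
    with near[OF that] m have "\<bar>real (a j) / h - real j\<bar> < 1"
      by (simp add: field_simps flip: diff_divide_distrib)
    then have "real j - 1 < real (a j) / h" "real (a j) / h < real j + 1" by auto
    then show "real j * h - h < real (a j)" "real (a j) < real j * h + h"
      using h by (simp_all add: field_simps)
  qed
  have "a m \<in> A" using a m by auto
  then obtain n where n: "enumerate A n = a m"
    using enumerate_Ex[OF A(2)] by blast
  \<comment> \<open>The last grid point is \<open>b\<close>, so \<open>a m\<close> is at least \<open>b / 2\<close>; this turns \<open>3 * h\<close> into the constant \<open>6\<close>.\<close>
  have "real b / 2 \<le> real b - h"
    using m b0 by (simp add: h_def field_simps)
  then have "real b \<le> 2 * real (a m)"
    using grid(1)[of m] m mh by auto
  then have bound: "3 * h \<le> 6 / real m * real (a m)"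
    using m by (simp add: h_def field_simps)
  have "a 1 \<in> A" using a m by auto
  then have "enumerate A 0 \<le> a 1"
    by (simp add: enumerate_0 Least_le)
  then have "real (enumerate A 0) < 3 * h"
    using grid(2)[of 1] m h by auto
  moreover have "real (enumerate A (Suc i)) - real (enumerate A i) < 3 * h" if i: "i < n" for i
  proof (rule ccontr)
    let ?p = "enumerate A i" and ?q = "enumerate A (Suc i)"
    assume "\<not> ?thesis"
    then have long: "real ?p + 3 * h \<le> real ?q" by simp
    have "?q \<le> a m"
      using enumerate_mono_le_iff[OF A(2), of "Suc i" n] i n by simp
    then have q: "real ?q < real m * h + h"
      using grid(2)[of m] m by auto
    \<comment> \<open>The first grid point at distance at least \<open>h\<close> above \<open>?p\<close>.\<close>
    define j where "j = nat \<lceil>real ?p / h\<rceil> + 1"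
    have "0 \<le> real ?p / h" using h by simp
    then have "real ?p / h \<le> real j - 1" "real j - 1 < real ?p / h + 1"
      by (simp_all add: j_def) linarith+
    then have j: "real ?p \<le> real j * h - h" "real j * h - h < real ?p + h"
      using h by (simp_all add: field_simps)
    have "real j * h < real m * h" using j(2) long q by linarith
    then have "j \<le> m" using h by simp
    then have jm: "j \<in> {1..m}" by (simp add: j_def)
    have "?p < a j" "a j < ?q"
      using grid[OF jm] j long by linarith+
    moreover have "a j \<in> A" using a jm by auto
    ultimately show False
      using enumerate_Suc''[OF A(2), of i] not_less_Least[of "a j" "\<lambda>s. s \<in> A \<and> ?p < s"] by simp
  qed
  ultimately have "short_gaps A n (6 / real m * real (enumerate A n))"
    unfolding short_gaps_def n using bound by force
  then show ?thesis ..
qed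

theorem theorem5:
  fixes A :: "nat set"
  assumes "A \<subseteq> {0<..}" and "infinite A"
  shows "dispersion A = 0 \<longleftrightarrow>
    (\<forall>k\<ge>2. pos_orthant k closure_of ratio_set k A = topspace (pos_orthant k))"
proof
  assume "dispersion A = 0"
  then have "\<forall>e>0. \<exists>n. short_gaps A n (e * real (enumerate A n))"
    by (simp add: dispersion_eq_0_iff[OF assms])
  then show "\<forall>k\<ge>2. pos_orthant k closure_of ratio_set k A = topspace (pos_orthant k)"
    unfolding ratio_set_dense_iff
    by (intro allI impI approximable_if_short_gaps[OF assms]) auto
next
  assume dense: "\<forall>k\<ge>2. pos_orthant k closure_of ratio_set k A = topspace (pos_orthant k)"
  have "\<exists>n. short_gaps A n (e * real (enumerate A n))" if e: "0 < e" for e :: real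
  proof -
    obtain m0 :: nat where "6 / e < real m0" using reals_Archimedean2 by blast
    define m where "m = max 2 m0"
    have m: "2 \<le> m" "6 / e < real m" using \<open>6 / e < real m0\<close> by (auto simp: m_def)
    then have me: "6 / real m \<le> e" using e by (simp add: field_simps)
    \<comment> \<open>The grid has \<open>m\<close> points, and \<open>m\<close> numerators mean \<open>k = m + 1\<close>.\<close>
    have "\<exists>a b. a \<in> {1..<Suc m} \<rightarrow> A \<and> b \<in> A \<and>
        (\<forall>j\<in>{1..<Suc m}. \<bar>real (a j) / real b - real j / real m\<bar> < 1 / real m)"
      using m(1)
      by (intro dense[unfolded ratio_set_dense_iff, rule_format,
            of "Suc m" "\<lambda>j. real j / real m" "1 / real m"]) simp_all
    then obtain a b where ab: "a \<in> {1..<Suc m} \<rightarrow> A" "b \<in> A"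
      "\<forall>j\<in>{1..<Suc m}. \<bar>real (a j) / real b - real j / real m\<bar> < 1 / real m"
      by blast
    then obtain n where n: "short_gaps A n (6 / real m * real (enumerate A n))"
      using short_gaps_if_approximable[OF assms m(1), of a b]
      by (auto simp: atLeastLessThanSuc_atLeastAtMost)
    have "6 / real m * real (enumerate A n) \<le> e * real (enumerate A n)"
      using me by (intro mult_right_mono) auto
    with n have "short_gaps A n (e * real (enumerate A n))"
      unfolding short_gaps_def by force
    then show ?thesis ..
  qed
  then show "dispersion A = 0"
    by (simp add: dispersion_eq_0_iff[OF assms])
qed

end
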